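(* Let $(T,F)$ be a rooted tree with a source over $(Q,\rho)$ and $M:=M(T,F)$. Let $\iota:T\to T$ be a non-identity idempotent quiver morphism satisfying $F\circ\iota=F$. Set $\mathrm{Im}(\iota):=\{\iota(n)\mid n\in T_0\}$ and let $T^1,\dots,T^k$ be the partition of $T_0\setminus\mathrm{Im}(\iota)$ such that $\langle T^1\rangle,\dots,\langle T^k\rangle$ are the connected components of $\langle T_0\setminus\mathrm{Im}(\iota)\rangle$. Put $M_0:=M(\langle\mathrm{Im}(\iota)\rangle,F|_{\langle\mathrm{Im}(\iota)\rangle})$ and $M_j:=M(\langle T^j\rangle,F|_{\langle T^j\rangle})$ for $1\le j\le k$. Then $M\cong\bigoplus_{j=0}^kM_j$ as $\Lambda$-modules.
   Context: Fix a field $\mathcal K$ with $\mathrm{char}(\mathcal K)\neq 2$. Let $Q=(Q_0,Q_1,\varsigma,\varepsilon)$ be a quiver and $\rho$ a set of paths in $Q$ of length at least $2$ that bounds the length of the paths, not lying in the ideal $\langle\rho\rangle$, passing through any vertex. Put $\Lambda:=\mathcal KQ/\langle\rho\rangle$. Finite-dimensional $\Lambda$-modules are identified with finite-dimensional $\mathcal K$-representations of $(Q,\rho)$. A tree is a finite quiver $T=(T_0,T_1,s,t)$ whose underlying undirected graph is connected without cycles. Here rooted trees have a unique source $\ast$ (the root). For $X\subseteq T_0$, $\langle X\rangle$ denotes the subquiver (subforest) of $T$ induced by $X$. With the notation of the claim, $\langle\mathrm{Im}(\iota)\rangle$ is a rooted subtree of $T$ with source $\ast$ and each $\langle T^j\rangle$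 is a rooted tree with a source. A quiver morphism is a pair of maps (on vertices and on arrows) commuting with sources and targets. A quiver morphism $F:T\to Q$ is bound, written $F:T\to(Q,\rho)$, if there is no path $p$ in $T$ with $F(p)\in\langle\rho\rangle$; then $(T,F)$ is a tree over $(Q,\rho)$. The rooted tree module $M(T,F)$ is the $\Lambda$-module with $\mathcal K$-basis $\{v_n\mid n\in T_0\}$, with $v_n$ at the vertex $F(n)$, where $\gamma\in Q_1$ acts by $\gamma\cdot v_n=\sum_{a\in T_1,\ s(a)=n,\ F(a)=\gamma}v_{t(a)}$. *)

theory Defs
  imports
    "Graph_Theory.Graph_Theory"
    "HOL-Library.Function_Algebras"
    "HOL-Library.Poly_Mapping"
    "HOL-Computational_Algebra.Computational_Algebra"
begin

text \<open>
  Quivers are well-formed \<open>pre_digraph\<close>s (loops and parallel arrows allowed); \<open>tail\<close> is the source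
  map and \<open>head\<close> the target map. A path is given by its starting vertex and the list of its arrows
  in the order in which they are traversed; \<open>(x, [])\<close> is the trivial path at \<open>x\<close>.
\<close>

type_synonym ('x, 'g) path = "'x \<times> 'g list"

definition paths :: "('x, 'g) pre_digraph \<Rightarrow> ('x, 'g) path set" where
  "paths Q = {p. \<exists>y. pre_digraph.awalk Q (fst p) (snd p) y}"

definition path_end :: "('x, 'g) pre_digraph \<Rightarrow> ('x, 'g) path \<Rightarrow> 'x" where
  "path_end Q p = last (pre_digraph.awalk_verts Q (fst p) (snd p))"


section \<open>The path algebra and bound quivers\<close>

definition path_algebra :: "('x, 'g) pre_digraph \<Rightarrow> (('x, 'g) path \<Rightarrow>\<^sub>0 'k::field) set" where
  "path_algebra Q = {f. Poly_Mapping.keys f \<subseteq> paths Q}"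

text \<open>
  Modules are left modules, so the product of the paths \<open>p\<close> and \<open>q\<close> is the path \<open>q\<close> followed by \<open>p\<close>.
\<close>

definition pa_mult ::
    "('x, 'g) pre_digraph \<Rightarrow> (('x, 'g) path \<Rightarrow>\<^sub>0 'k::field) \<Rightarrow> (('x, 'g) path \<Rightarrow>\<^sub>0 'k)
      \<Rightarrow> (('x, 'g) path \<Rightarrow>\<^sub>0 'k)" where
  "pa_mult Q f g = (\<Sum>p\<in>Poly_Mapping.keys f. \<Sum>q\<in>Poly_Mapping.keys g.
     if path_end Q q = fst p
     then Poly_Mapping.single (fst q, snd q @ snd p) (Poly_Mapping.lookup f p * Poly_Mapping.lookup g q) else 0)"

text \<open>
  The quiver may have infinitely many vertices, in which case the path algebra has no unit; therefore
  closure under scalars is part of the definition of an ideal.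
\<close>

definition pa_ideal ::
    "('x, 'g) pre_digraph \<Rightarrow> (('x, 'g) path \<Rightarrow>\<^sub>0 'k::field) set \<Rightarrow> bool" where
  "pa_ideal Q I \<longleftrightarrow>
     I \<subseteq> path_algebra Q \<and> 0 \<in> I \<and>
     (\<forall>f\<in>I. \<forall>g\<in>I. f + g \<in> I) \<and>
     (\<forall>c. \<forall>f\<in>I. Poly_Mapping.map (\<lambda>b. c * b) f \<in> I) \<and>
     (\<forall>f\<in>path_algebra Q. \<forall>g\<in>I. pa_mult Q f g \<in> I \<and> pa_mult Q g f \<in> I)"

definition ideal_gen ::
    "('x, 'g) pre_digraph \<Rightarrow> ('x, 'g) path set \<Rightarrow> (('x, 'g) path \<Rightarrow>\<^sub>0 'k::field) set" where
  "ideal_gen Q \<rho> = \<Inter>{I. pa_ideal Q I \<and> (\<forall>p\<in>\<rho>. Poly_Mapping.single p 1 \<in> I)}"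

definition path_in_ideal ::
    "'k::field itself \<Rightarrow> ('x, 'g) pre_digraph \<Rightarrow> ('x, 'g) path set \<Rightarrow> ('x, 'g) path \<Rightarrow> bool" where
  "path_in_ideal K Q \<rho> p \<longleftrightarrow> (Poly_Mapping.single p 1 :: ('x, 'g) path \<Rightarrow>\<^sub>0 'k) \<in> ideal_gen Q \<rho>"

text \<open>The bound on the length of the paths through a vertex may depend on the vertex.\<close>

definition bound_quiver ::
    "'k::field itself \<Rightarrow> ('x, 'g) pre_digraph \<Rightarrow> ('x, 'g) path set \<Rightarrow> bool" where
  "bound_quiver K Q \<rho> \<longleftrightarrow>
     wf_digraph Q \<and>
     \<rho> \<subseteq> paths Q \<and> (\<forall>p\<in>\<rho>. 2 \<le> length (snd p)) \<and>
     (\<forall>x\<in>verts Q. \<exists>N. \<forall>p\<in>paths Q.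
        \<not> path_in_ideal K Q \<rho> p \<and> x \<in> set (pre_digraph.awalk_verts Q (fst p) (snd p))
        \<longrightarrow> length (snd p) \<le> N)"


section \<open>Representations of bound quivers\<close>

text \<open>
  Finite-dimensional modules over \<open>KQ/\<langle>\<rho>\<rangle>\<close> are identified with finite-dimensional representations of
  \<open>(Q, \<rho>)\<close>. The spaces of a representation are subspaces of one ambient vector space (the type
  \<open>'m\<close> with the scalar multiplication \<open>rscale\<close>); \<open>rspace x\<close> is the space at the vertex \<open>x\<close> and
  \<open>rmap \<gamma>\<close> is relevant only on the space at the source of \<open>\<gamma>\<close>.
\<close>

record ('x, 'g, 'k, 'm) qrep =
  rscale :: "'k \<Rightarrow> 'm \<Rightarrow> 'm"
  rspace :: "'x \<Rightarrow> 'm set"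
  rmap :: "'g \<Rightarrow> 'm \<Rightarrow> 'm"

definition linear_between ::
    "('k \<Rightarrow> 'm \<Rightarrow> 'm) \<Rightarrow> 'm set \<Rightarrow> ('k \<Rightarrow> 'l \<Rightarrow> 'l) \<Rightarrow> 'l set \<Rightarrow> ('m::ab_group_add \<Rightarrow> 'l::ab_group_add)
      \<Rightarrow> bool" where
  "linear_between s V t W f \<longleftrightarrow>
     (\<forall>v\<in>V. f v \<in> W) \<and>
     (\<forall>v\<in>V. \<forall>w\<in>V. f (v + w) = f v + f w) \<and>
     (\<forall>c. \<forall>v\<in>V. f (s c v) = t c (f v))"

definition fd_rep ::
    "('x, 'g) pre_digraph \<Rightarrow> ('x, 'g) path set \<Rightarrow> ('x, 'g, 'k::field, 'm::ab_group_add) qrep \<Rightarrow> bool"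
where
  "fd_rep Q \<rho> V \<longleftrightarrow>
     vector_space (rscale V) \<and>
     (\<forall>x\<in>verts Q. \<exists>B. finite B \<and> module.span (rscale V) B = rspace V x) \<and>
     finite {x\<in>verts Q. rspace V x \<noteq> {0}} \<and>
     (\<forall>\<gamma>\<in>arcs Q. linear_between (rscale V) (rspace V (tail Q \<gamma>))
                                 (rscale V) (rspace V (head Q \<gamma>)) (rmap V \<gamma>)) \<and>
     (\<forall>p\<in>\<rho>. \<forall>v\<in>rspace V (fst p). fold (rmap V) (snd p) v = 0)"

definition rep_iso ::
    "('x, 'g) pre_digraph \<Rightarrow> ('x, 'g) path set \<Rightarrow> ('x, 'g, 'k::field, 'm::ab_group_add) qrep
      \<Rightarrow> ('x, 'g, 'k, 'l::ab_group_add) qrep \<Rightarrow> bool" where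
  "rep_iso Q \<rho> V W \<longleftrightarrow>
     fd_rep Q \<rho> V \<and> fd_rep Q \<rho> W \<and>
     (\<exists>\<phi>. (\<forall>x\<in>verts Q. linear_between (rscale V) (rspace V x) (rscale W) (rspace W x) (\<phi> x) \<and>
                       bij_betw (\<phi> x) (rspace V x) (rspace W x)) \<and>
          (\<forall>\<gamma>\<in>arcs Q. \<forall>v\<in>rspace V (tail Q \<gamma>).
             \<phi> (head Q \<gamma>) (rmap V \<gamma> v) = rmap W \<gamma> (\<phi> (tail Q \<gamma>) v)))"

text \<open>The external direct sum of the representations \<open>V i\<close>, \<open>i \<in> I\<close>, for a finite set \<open>I\<close>.\<close>

definition rep_dsum ::
    "'i set \<Rightarrow> ('i \<Rightarrow> ('x, 'g, 'k::field, 'm::ab_group_add) qrep) \<Rightarrow> ('x, 'g, 'k, 'i \<Rightarrow> 'm) qrep" where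
  "rep_dsum I V =
     \<lparr> rscale = (\<lambda>c f i. rscale (V i) c (f i)),
       rspace = (\<lambda>x. {f. (\<forall>i\<in>I. f i \<in> rspace (V i) x) \<and> (\<forall>i. i \<notin> I \<longrightarrow> f i = 0)}),
       rmap = (\<lambda>\<gamma> f i. if i \<in> I then rmap (V i) \<gamma> (f i) else 0) \<rparr>"


section \<open>Trees and tree modules\<close>

text \<open>
  The underlying undirected graph of \<open>T\<close> as a quiver: each arrow \<open>a\<close> may be traversed forwards,
  \<open>(a, True)\<close>, or backwards, \<open>(a, False)\<close>. Parallel arrows stay distinct, in contrast to
  \<open>mk_symmetric\<close>, so that two parallel arrows form a cycle (as does a loop). Note that \<open>forest\<close> and
  \<open>tree\<close> of \<open>Graph_Theory\<close> only exclude directed cycles.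
\<close>

definition undirected :: "('n, 'a) pre_digraph \<Rightarrow> ('n, 'a \<times> bool) pre_digraph" where
  "undirected T =
     \<lparr> verts = verts T, arcs = arcs T \<times> UNIV,
       tail = (\<lambda>(a, b). if b then tail T a else head T a),
       head = (\<lambda>(a, b). if b then head T a else tail T a) \<rparr>"

definition undirected_cycle :: "('n, 'a) pre_digraph \<Rightarrow> ('a \<times> bool) list \<Rightarrow> bool" where
  "undirected_cycle T p \<longleftrightarrow> pre_digraph.cycle (undirected T) p \<and> distinct (map fst p)"

definition quiver_tree :: "('n, 'a) pre_digraph \<Rightarrow> bool" where
  "quiver_tree T \<longleftrightarrow> fin_digraph T \<and> Digraph_Component.connected T \<and> \<not> (\<exists>p. undirected_cycle T p)"

definition rooted_tree :: "('n, 'a) pre_digraph \<Rightarrow> bool" where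
  "rooted_tree T \<longleftrightarrow> quiver_tree T \<and> (\<exists>!r. r \<in> verts T \<and> in_arcs T r = {})"

definition components :: "('n, 'a) pre_digraph \<Rightarrow> 'n set set" where
  "components G = {X. X \<subseteq> verts G \<and> Digraph_Component.connected (G \<restriction> X) \<and>
                      (\<forall>Y. X \<subset> Y \<and> Y \<subseteq> verts G \<longrightarrow> \<not> Digraph_Component.connected (G \<restriction> Y))}"

definition quiver_morphism ::
    "('n, 'a) pre_digraph \<Rightarrow> ('x, 'g) pre_digraph \<Rightarrow> ('n \<Rightarrow> 'x) \<Rightarrow> ('a \<Rightarrow> 'g) \<Rightarrow> bool" where
  "quiver_morphism T Q F0 F1 \<longleftrightarrow>
     (\<forall>n\<in>verts T. F0 n \<in> verts Q) \<and>
     (\<forall>a\<in>arcs T. F1 a \<in> arcs Q \<and> tail Q (F1 a) = F0 (tail T a) \<and> head Q (F1 a) = F0 (head T a))"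

definition bound_morphism ::
    "'k::field itself \<Rightarrow> ('n, 'a) pre_digraph \<Rightarrow> ('x, 'g) pre_digraph \<Rightarrow> ('x, 'g) path set
      \<Rightarrow> ('n \<Rightarrow> 'x) \<Rightarrow> ('a \<Rightarrow> 'g) \<Rightarrow> bool" where
  "bound_morphism K T Q \<rho> F0 F1 \<longleftrightarrow>
     quiver_morphism T Q F0 F1 \<and>
     \<not> (\<exists>p\<in>paths T. path_in_ideal K Q \<rho> (F0 (fst p), map F1 (snd p)))"

definition basis_vec :: "'n \<Rightarrow> 'n \<Rightarrow> 'k::field" where
  "basis_vec n = (\<lambda>m. if m = n then 1 else 0)"

definition fun_scale :: "'k::field \<Rightarrow> ('n \<Rightarrow> 'k) \<Rightarrow> 'n \<Rightarrow> 'k" where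
  "fun_scale c f = (\<lambda>n. c * f n)"

text \<open>
  The space at \<open>x\<close> has the basis \<open>basis_vec n\<close>, \<open>n \<in> verts T\<close>, \<open>F0 n = x\<close>; the arrows of \<open>Q\<close> act by
  linear extension of the formula for \<open>\<gamma> \<cdot> v\<^sub>n\<close>.
\<close>

definition tree_module ::
    "('n, 'a) pre_digraph \<Rightarrow> ('n \<Rightarrow> 'x) \<Rightarrow> ('a \<Rightarrow> 'g) \<Rightarrow> ('x, 'g, 'k::field, 'n \<Rightarrow> 'k) qrep" where
  "tree_module T F0 F1 =
     \<lparr> rscale = fun_scale,
       rspace = (\<lambda>x. {f. \<forall>n. f n \<noteq> 0 \<longrightarrow> n \<in> verts T \<and> F0 n = x}),
       rmap = (\<lambda>\<gamma> f. \<Sum>n\<in>verts T. fun_scale (f n)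
                 (\<Sum>a\<in>{a\<in>arcs T. tail T a = n \<and> F1 a = \<gamma>}. basis_vec (head T a))) \<rparr>"

end

(*
  In a rooted tree every vertex has at most one incoming arrow, so an arrow acts on a vector f of the
  tree module by (gamma f)(m) = f(tail a) if the arrow a into m exists and lies over gamma, and by 0
  otherwise. The image I of iota contains the root and is closed under predecessors, and iota maps the
  arrow into m to the arrow into iota m. Hence f |-> f|I and f |-> (m |-> f m - f (iota m)), the latter
  restricted to a component of the complement of I, are homomorphisms: an arrow entering a component
  from I contributes f(tail a) - f(iota (tail a)) = 0. Together they form an isomorphism.
*)

theory Submission
  imports Defs
begin

section \<open>Trees and connected components\<close>

text \<open>Following incoming arrows backwards must stop, since a finite acyclic arc relation is
  well-founded, and it can only stop at \<open>r\<close>.\<close>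

lemma (in fin_digraph) reachable_from_unique_source:
  assumes acyc: "\<nexists>p. cycle p"
    and r: "\<And>n. n \<in> verts G \<Longrightarrow> in_arcs G n = {} \<Longrightarrow> n = r"
    and n: "n \<in> verts G"
  shows "r \<rightarrow>\<^sup>* n"
proof -
  have "acyclic (arcs_ends G)"
    unfolding acyclic_def using acyc closed_w_imp_cycle
    by (auto simp: reachable1_awalk closed_w_def)
  moreover have "finite (arcs_ends G)"
    by (simp add: arcs_ends_conv)
  ultimately have "wf (arcs_ends G)"
    by (rule finite_acyclic_wf[rotated])
  then show ?thesis
    using n
  proof (induction n rule: wf_induct_rule)
    case (less n)
    show ?case
    proof (cases "in_arcs G n = {}")
      case True
      then show ?thesis using r less.prems by auto
    next
      case False
      then obtain a where a: "a \<in> arcs G" "head G a = n" by (auto simp: in_arcs_def)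
      then have "(tail G a, n) \<in> arcs_ends G"
        by (auto simp: arcs_ends_conv)
      with less.IH[OF this] a show ?thesis
        by (meson reachable_adj_trans tail_in_verts)
    qed
  qed
qed

section \<open>Walks and cycles in the underlying undirected graph\<close>

lemma undirected_simps [simp]:
  "verts (undirected T) = verts T"
  "arcs (undirected T) = arcs T \<times> UNIV"
  "tail (undirected T) (a, b) = (if b then tail T a else head T a)"
  "head (undirected T) (a, b) = (if b then head T a else tail T a)"
  by (simp_all add: undirected_def)

lemma (in wf_digraph) wf_undirected: "wf_digraph (undirected G)"
  by unfold_locales (auto simp: undirected_def)

lemma (in wf_digraph) awalk_undirected_forward:
  assumes "awalk u p v"
  shows "pre_digraph.awalk (undirected G) u (map (\<lambda>a. (a, True)) p) v"
proof -
  interpret U: wf_digraph "undirected G" by (rule wf_undirected)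
  show ?thesis using assms
    by (induction p arbitrary: u) (auto simp: awalk_simps U.awalk_simps)
qed

lemma (in wf_digraph) awalk_undirected_backward:
  assumes "awalk u p v"
  shows "pre_digraph.awalk (undirected G) v (rev (map (\<lambda>a. (a, False)) p)) u"
proof -
  interpret U: wf_digraph "undirected G" by (rule wf_undirected)
  show ?thesis using assms
  proof (induction p arbitrary: u)
    case (Cons a p)
    then have "U.awalk v (rev (map (\<lambda>a. (a, False)) p)) (head G a)"
      by (auto simp: awalk_simps)
    moreover have "U.awalk (head G a) [(a, False)] u"
      using Cons.prems by (auto simp: awalk_simps U.awalk_simps)
    ultimately show ?case
      using U.awalk_appendI by fastforce
  qed (auto simp: awalk_simps U.awalk_simps)
qed

text \<open>Turns distinctness of visited vertices into distinctness of a list of heads, the form in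
  which cycles are built below.\<close>

lemma (in wf_digraph) awalk_verts_eq_Cons_heads:
  "awalk u p v \<Longrightarrow> awalk_verts u p = u # map (head G) p"
  by (induction p arbitrary: u) (auto simp: awalk_simps)

lemma (in wf_digraph) undirected_cycleI:
  assumes w: "pre_digraph.awalk (undirected G) u p u" and "p \<noteq> []"
    and d: "distinct (map (head (undirected G)) p)" "distinct (map fst p)"
  shows "undirected_cycle G p"
proof -
  interpret U: wf_digraph "undirected G" by (rule wf_undirected)
  have "tl (U.awalk_verts u p) = map (head (undirected G)) p"
    using U.awalk_verts_eq_Cons_heads[OF w] by simp
  then show ?thesis
    unfolding undirected_cycle_def U.cycle_def using assms by auto
qed


text \<open>Traversing every arrow forwards turns a directed cycle into an undirected one. Thus the
  acyclicity in \<open>quiver_tree\<close> also excludes directed cycles.\<close>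

lemma (in wf_digraph) cycle_imp_undirected_cycle:
  assumes "cycle p"
  shows "\<exists>q. undirected_cycle G q"
proof -
  obtain u where u: "awalk u p u" "distinct (tl (awalk_verts u p))" "p \<noteq> []" "distinct p"
    using assms unfolding cycle_conv by auto
  then have "distinct (map (head G) p)" by (simp add: awalk_verts_eq_Cons_heads)
  then have "undirected_cycle G (map (\<lambda>a. (a, True)) p)"
    using u awalk_undirected_forward[OF u(1)]
    by (intro undirected_cycleI[of u]) (auto simp: o_def)
  then show ?thesis by blast
qed

text \<open>
  Choosing the two walks of minimal total length makes them paths that meet only in \<open>x\<close>, so that
  together with \<open>a\<close> and \<open>b\<close> they form an undirected cycle.
\<close>

lemma (in wf_digraph) in_arc_unique:
  assumes acyc: "\<nexists>p. undirected_cycle G p"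
    and reach: "\<And>n. n \<in> verts G \<Longrightarrow> r \<rightarrow>\<^sup>* n"
    and a: "a \<in> arcs G" and b: "b \<in> arcs G" and ab: "head G a = head G b"
  shows "a = b"
proof (rule ccontr)
  assume neq: "a \<noteq> b"
  have nocyc: "p = []" if "awalk u p u" for u p
    using that acyc cycle_imp_undirected_cycle closed_w_imp_cycle
    unfolding closed_w_def by blast
  \<comment> \<open>A common start \<open>x\<close> with directed walks to the tails of
    \<open>a\<close> and \<open>b\<close>; the root \<open>r\<close> provides one such
    triple.\<close>
  define P where "P = (\<lambda>(x, p, q). awalk x p (tail G a) \<and> awalk x q (tail G b))"
  obtain p0 q0 where "P (r, p0, q0)"
    unfolding P_def using reach a b by (fastforce simp: reachable_awalk)
  then obtain w where w: "P w"
    and min_w: "\<And>w'. P w' \<Longrightarrow> length (fst (snd w)) + length (snd (snd w))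
                     \<le> length (fst (snd w')) + length (snd (snd w'))"
    using ex_has_least_nat[of P _ "\<lambda>w. length (fst (snd w)) + length (snd (snd w))"] by blast
  obtain x p q where "w = (x, p, q)" by (cases w)
  with w have p: "awalk x p (tail G a)" and q: "awalk x q (tail G b)"
    by (auto simp: P_def)
  have min: "length p + length q \<le> length p' + length q'"
    if "awalk y p' (tail G a)" "awalk y q' (tail G b)" for y p' q'
    using min_w[of "(y, p', q')"] that \<open>w = _\<close> by (auto simp: P_def)
  \<comment> \<open>A repeated vertex would cut out a nonempty closed subwalk, which
    \<open>nocyc\<close> forbids.\<close>
  have dist: "distinct (awalk_verts u s)" if "awalk u s v" for u s v
    using awalk_not_distinct_decomp[OF that] nocyc by force
  have tl_dist: "distinct (map (head G) s)" "u \<notin> set (map (head G) s)" if "awalk u s v" for u s v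
    using dist[OF that] awalk_verts_eq_Cons_heads[OF that] by auto
  have pa: "awalk x (p @ [a]) (head G a)" and qb: "awalk x (q @ [b]) (head G a)"
    using awalk_appendI[OF p arc_implies_awalk[OF a]] awalk_appendI[OF q arc_implies_awalk[OF b]] ab
    by auto
  \<comment> \<open>If both walks met at some \<open>y\<close>, starting at \<open>y\<close> instead
    of \<open>x\<close> would give a shorter pair.\<close>
  have disj: "set (map (head G) p) \<inter> set (map (head G) q) = {}"
  proof (rule ccontr)
    assume "\<not> ?thesis"
    then obtain y where y: "y \<in> set (map (head G) p)" "y \<in> set (map (head G) q)" by blast
    then obtain p1 p2 where p12: "p = p1 @ p2" "awalk x p1 y" "awalk y p2 (tail G a)"
      using awalk_decomp[OF p, of y] by (auto simp: set_awalk_verts[OF p])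
    obtain q1 q2 where q12: "q = q1 @ q2" "awalk x q1 y" "awalk y q2 (tail G b)"
      using awalk_decomp[OF q, of y] y by (auto simp: set_awalk_verts[OF q])
    have "x \<noteq> y" using tl_dist(2)[OF p] y by auto
    then have "p1 \<noteq> []" using p12 by (auto simp: awalk_simps)
    then show False using min[OF p12(3) q12(3)] p12 q12 by auto
  qed
  \<comment> \<open>Forwards along \<open>p\<close> and \<open>a\<close>, then backwards along
    \<open>b\<close> and \<open>q\<close>, returning to \<open>x\<close>.\<close>
  define c where "c = map (\<lambda>a. (a, True)) (p @ [a]) @ rev (map (\<lambda>a. (a, False)) (q @ [b]))"
  interpret U: wf_digraph "undirected G" by (rule wf_undirected)
  have "U.awalk x c x"
    unfolding c_def
    using U.awalk_appendI[OF awalk_undirected_forward[OF pa] awalk_undirected_backward[OF qb]] .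
  moreover have "c \<noteq> []" by (simp add: c_def)
  moreover have "distinct (map fst c)"
  proof -
    have "distinct (p @ [a])" "distinct (q @ [b])"
      using tl_dist(1)[OF pa] tl_dist(1)[OF qb] by (metis distinct_map)+
    \<comment> \<open>A shared arrow would have a shared head. The heads in \<open>p\<close> and
      \<open>q\<close> are disjoint, the common head of \<open>a\<close> and \<open>b\<close> occurs
      in neither, and \<open>a\<close> differs from \<open>b\<close>.\<close>
    moreover have "set (p @ [a]) \<inter> set (q @ [b]) = {}"
      using disj neq tl_dist(1)[OF pa] tl_dist(1)[OF qb] ab by (auto simp: image_iff)
    ultimately show ?thesis
      unfolding c_def by (auto simp: o_def rev_map)
  qed
  moreover have "distinct (map (head (undirected G)) c)"
  proof -
    have *: "map (head (undirected G)) c = map (head G) (p @ [a]) @ rev (map (tail G) (q @ [b]))"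
      by (simp add: c_def o_def rev_map)
    \<comment> \<open>The backward part enters the tails of its arrows; along a walk these are the
      start followed by all heads but the last.\<close>
    have **: "map (tail G) (q @ [b]) = x # map (head G) q"
      using awalk_verts_conv[of x "q @ [b]"] awalk_verts_eq_Cons_heads[OF qb] by simp
    show ?thesis
      unfolding * ** using tl_dist[OF pa] tl_dist[OF qb] disj ab by auto
  qed
  ultimately show False using acyc undirected_cycleI by blast
qed

section \<open>Connected components of induced subquivers\<close>

lemma connected_induce_conv:
  "connected (G \<restriction> X) \<longleftrightarrow>
     X \<noteq> {} \<and> (\<forall>u\<in>X. \<forall>v\<in>X. (u, v) \<in> rtrancl_on X ((arcs_ends (G \<restriction> X))\<^sup>s))"
  by (simp add: connected_conv)

text \<open>Any two vertices of the union are linked through a vertex of the intersection.\<close>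

lemma connected_induce_Un:
  assumes X: "connected (G \<restriction> X)" and Y: "connected (G \<restriction> Y)" and XY: "X \<inter> Y \<noteq> {}"
  shows "connected (G \<restriction> (X \<union> Y))"
proof -
  let ?R = "\<lambda>Z. rtrancl_on Z ((arcs_ends (G \<restriction> Z))\<^sup>s)"
  have mono: "(u, v) \<in> ?R (X \<union> Y)" if "(u, v) \<in> ?R Z" "Z \<subseteq> X \<union> Y" for u v Z
    using that by (elim rtrancl_on_mono[rotated 2]) (fastforce simp: symcl_def arcs_ends_conv image_iff)
  obtain z where z: "z \<in> X" "z \<in> Y" using XY by auto
  have "(u, z) \<in> ?R (X \<union> Y)" "(z, u) \<in> ?R (X \<union> Y)" if "u \<in> X \<union> Y" for u
    using that X Y z mono[of _ _ X] mono[of _ _ Y] unfolding connected_induce_conv by blast+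
  then show ?thesis
    unfolding connected_induce_conv using z by (blast intro: rtrancl_on_trans)
qed

lemma connected_induce_arc:
  assumes "a \<in> arcs G"
  shows "connected (G \<restriction> {tail G a, head G a})"
proof -
  let ?X = "{tail G a, head G a}"
  have "(tail G a, head G a) \<in> (arcs_ends (G \<restriction> ?X))\<^sup>s" "(head G a, tail G a) \<in> (arcs_ends (G \<restriction> ?X))\<^sup>s"
    using assms by (auto simp: symcl_def arcs_ends_conv)
  then show ?thesis
    unfolding connected_induce_conv
    by (auto intro: rtrancl_on_into_rtrancl_on[OF rtrancl_on_refl])
qed

text \<open>The union of two components that meet is connected, so by maximality it equals
  both.\<close>

lemma components_disjoint:
  assumes "X \<in> components G" "Y \<in> components G" "X \<inter> Y \<noteq> {}"
  shows "X = Y"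
proof -
  have "connected (G \<restriction> (X \<union> Y))"
    using assms by (intro connected_induce_Un) (auto simp: components_def)
  with assms(1,2) show ?thesis
    unfolding components_def by (metis (no_types, lifting) mem_Collect_eq psubsetI Un_least sup.cobounded1 sup.cobounded2)
qed

text \<open>If an arrow had just one end in \<open>X\<close>, adding its other end would give a
  larger connected set.\<close>

lemma (in wf_digraph) components_closed_arc:
  assumes "X \<in> components G" "a \<in> arcs G"
  shows "tail G a \<in> X \<longleftrightarrow> head G a \<in> X"
proof (rule ccontr)
  let ?Y = "{tail G a, head G a}"
  assume n: "\<not> ?thesis"
  then have "X \<inter> ?Y \<noteq> {}" "X \<subset> X \<union> ?Y" by auto
  moreover have "connected (G \<restriction> (X \<union> ?Y))"
    using assms \<open>X \<inter> ?Y \<noteq> {}\<close>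
    by (intro connected_induce_Un connected_induce_arc) (auto simp: components_def)
  ultimately show False
    using assms unfolding components_def by auto
qed

lemma Union_components:
  assumes "finite (verts G)"
  shows "\<Union>(components G) = verts G"
proof
  show "verts G \<subseteq> \<Union>(components G)"
  proof
    fix v assume v: "v \<in> verts G"
    \<comment> \<open>By finiteness this set of candidates has a maximal element above
      \<open>{v}\<close>. It is a component: any connected superset still contains
      \<open>v\<close>.\<close>
    let ?S = "{X. X \<subseteq> verts G \<and> v \<in> X \<and> connected (G \<restriction> X)}"
    have "finite ?S" using assms by (rule finite_subset[rotated, OF finite_Pow_iff[THEN iffD2]]) auto
    moreover have "{v} \<in> ?S" using v by (auto simp: connected_induce_conv)
    ultimately obtain X where X: "X \<in> ?S" "\<forall>Y\<in>?S. X \<subseteq> Y \<longrightarrow> X = Y"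
      by (metis (no_types, lifting) finite_has_maximal empty_iff)
    then have "X \<in> components G"
      unfolding components_def by blast
    with X show "v \<in> \<Union>(components G)" by auto
  qed
qed (auto simp: components_def)

section \<open>Tree modules and direct sums as representations\<close>

lemma sum_fun_apply: "(\<Sum>i\<in>A. f i) x = (\<Sum>i\<in>A. f i x)"
  by (induction A rule: infinite_finite_induct) auto

lemma tree_module_simps [simp]:
  "rscale (tree_module T F0 F1) = fun_scale"
  "f \<in> rspace (tree_module T F0 F1) x \<longleftrightarrow> (\<forall>n. f n \<noteq> 0 \<longrightarrow> n \<in> verts T \<and> F0 n = x)"
  by (simp_all add: tree_module_def)

text \<open>The defining sum pushes coefficients along arrows grouped by tail. Regrouping by head
  gives a pointwise formula that only looks at arrows into \<open>m\<close>.\<close>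

lemma (in fin_digraph) rmap_tree_module:
  "rmap (tree_module G F0 F1) \<gamma> f = (\<lambda>m. \<Sum>a\<in>{a\<in>in_arcs G m. F1 a = \<gamma>}. f (tail G a))"
proof
  fix m
  have "rmap (tree_module G F0 F1) \<gamma> f m =
      (\<Sum>n\<in>verts G. \<Sum>a | a \<in> {a \<in> arcs G. F1 a = \<gamma>} \<and> tail G a = n. if m = head G a then f (tail G a) else 0)"
    unfolding tree_module_def
    by (auto simp: sum_fun_apply fun_scale_def basis_vec_def sum_distrib_left intro!: sum.cong)
  also have "\<dots> = (\<Sum>a\<in>{a \<in> arcs G. F1 a = \<gamma>}. if m = head G a then f (tail G a) else 0)"
    by (rule sum.group) auto
  also have "\<dots> = (\<Sum>a\<in>{a\<in>in_arcs G m. F1 a = \<gamma>}. f (tail G a))"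
    by (rule sum.mono_neutral_cong_right) auto
  finally show "rmap (tree_module G F0 F1) \<gamma> f m = \<dots>" .
qed

lemma (in fin_digraph) rmap_tree_module_nonzeroE:
  assumes "rmap (tree_module G F0 F1) \<gamma> f m \<noteq> 0"
  obtains a where "a \<in> arcs G" "head G a = m" "F1 a = \<gamma>" "f (tail G a) \<noteq> 0"
  using assms unfolding rmap_tree_module
  by (auto elim!: sum.not_neutral_contains_not_neutral)

lemma vector_space_fun_scale: "vector_space (fun_scale :: 'k::field \<Rightarrow> _)"
  by unfold_locales (auto simp: fun_scale_def algebra_simps fun_eq_iff)

text \<open>A nonzero coefficient can be traced back arrow by arrow, which lifts \<open>gs\<close>
  to a path of the tree. The assumption on the support makes the trivial path at \<open>m\<close> a
  walk when \<open>gs\<close> is empty.\<close>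

lemma (in fin_digraph) fold_rmap_tree_module_nonzero:
  assumes "fold (rmap (tree_module G F0 F1)) gs f m \<noteq> 0"
    and "\<And>n. f n \<noteq> 0 \<Longrightarrow> n \<in> verts G"
  shows "\<exists>n p. awalk n p m \<and> map F1 p = gs \<and> f n \<noteq> 0"
  using assms
proof (induction gs arbitrary: f)
  case Nil
  then show ?case by (auto simp: awalk_simps)
next
  case (Cons g gs)
  let ?h = "rmap (tree_module G F0 F1) g f"
  have "n \<in> verts G" if "?h n \<noteq> 0" for n
    using that by (rule rmap_tree_module_nonzeroE) auto
  then obtain n p where "awalk n p m" "map F1 p = gs" "?h n \<noteq> 0"
    using Cons.IH[of ?h] Cons.prems(1) unfolding fold_simps by blast
  moreover from this(3) obtain a where "a \<in> arcs G" "head G a = n" "F1 a = g" "f (tail G a) \<noteq> 0"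
    by (rule rmap_tree_module_nonzeroE)
  ultimately have "awalk (tail G a) (a # p) m" "map F1 (a # p) = g # gs" "f (tail G a) \<noteq> 0"
    by (auto simp: awalk_simps)
  then show ?case
    by (intro exI[of _ "tail G a"] exI[of _ "a # p"] conjI)
qed

lemma fd_rep_tree_module:
  assumes "fin_digraph T" and bm: "bound_morphism TYPE('k::field) T Q \<rho> F0 F1"
  shows "fd_rep Q \<rho> (tree_module T F0 F1 :: ('x, 'g, 'k, 'n \<Rightarrow> 'k) qrep)"
proof -
  interpret fin_digraph T by fact
  interpret vector_space "fun_scale :: 'k \<Rightarrow> ('n \<Rightarrow> 'k) \<Rightarrow> _" by (rule vector_space_fun_scale)
  let ?M = "tree_module T F0 F1 :: ('x, 'g, 'k, 'n \<Rightarrow> 'k) qrep"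
  have qm: "quiver_morphism T Q F0 F1"
    using bm by (simp add: bound_morphism_def)
  have span: "\<exists>B. finite B \<and> span B = rspace ?M x" for x
  proof (intro exI conjI)
    let ?N = "{n \<in> verts T. F0 n = x}"
    show "finite (basis_vec ` ?N)" by simp
    show "span (basis_vec ` ?N) = rspace ?M x"
    proof
      have "subspace (rspace ?M x)"
      proof (rule subspaceI)
        show "f + g \<in> rspace ?M x" if "f \<in> rspace ?M x" "g \<in> rspace ?M x" for f g
          using that unfolding tree_module_simps plus_fun_apply by (metis add.right_neutral)
      qed (simp_all add: fun_scale_def)
      then show "span (basis_vec ` ?N) \<subseteq> rspace ?M x"
        by (intro span_minimal) (auto simp: basis_vec_def split: if_splits)
      show "rspace ?M x \<subseteq> span (basis_vec ` ?N)"
      proof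
        fix f assume f: "f \<in> rspace ?M x"
        have "f = (\<Sum>n\<in>?N. fun_scale (f n) (basis_vec n))"
        proof (intro ext)
          fix m
          have "(\<Sum>n\<in>?N. fun_scale (f n) (basis_vec n)) m = (\<Sum>n\<in>?N. if n = m then f n else 0)"
            unfolding sum_fun_apply by (intro sum.cong) (auto simp: fun_scale_def basis_vec_def)
          also have "\<dots> = f m"
            using f by (auto simp: sum.delta)
          finally show "f m = (\<Sum>n\<in>?N. fun_scale (f n) (basis_vec n)) m" ..
        qed
        also have "\<dots> \<in> span (basis_vec ` ?N)"
          by (intro span_sum span_scale span_base) auto
        finally show "f \<in> span (basis_vec ` ?N)" .
      qed
    qed
  qed
  have "{x \<in> verts Q. rspace ?M x \<noteq> {0}} \<subseteq> F0 ` verts T"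
  proof
    fix x assume "x \<in> {x \<in> verts Q. rspace ?M x \<noteq> {0}}"
    moreover have "0 \<in> rspace ?M x" by simp
    ultimately obtain f where "f \<in> rspace ?M x" "f \<noteq> 0" by blast
    then show "x \<in> F0 ` verts T" by (auto simp: fun_eq_iff)
  qed
  then have fin: "finite {x \<in> verts Q. rspace ?M x \<noteq> {0}}"
    by (rule finite_subset) simp
  have lin: "linear_between fun_scale (rspace ?M (tail Q \<gamma>)) fun_scale (rspace ?M (head Q \<gamma>)) (rmap ?M \<gamma>)"
    if "\<gamma> \<in> arcs Q" for \<gamma>
    unfolding linear_between_def
  proof (intro conjI ballI allI)
    fix f assume "f \<in> rspace ?M (tail Q \<gamma>)"
    show "rmap ?M \<gamma> f \<in> rspace ?M (head Q \<gamma>)"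
      unfolding tree_module_simps
    proof (intro allI impI)
      fix m assume "rmap ?M \<gamma> f m \<noteq> 0"
      then obtain a where "a \<in> arcs T" "head T a = m" "F1 a = \<gamma>"
        by (rule rmap_tree_module_nonzeroE)
      then show "m \<in> verts T \<and> F0 m = head Q \<gamma>"
        using qm by (auto simp: quiver_morphism_def)
    qed
  qed (simp_all add: rmap_tree_module fun_eq_iff sum.distrib fun_scale_def sum_distrib_left)
  \<comment> \<open>If a relation \<open>p\<close> acted nontrivially, it would lift to a path of
    \<open>T\<close> whose image is exactly \<open>p\<close>, contradicting that the morphism is
    bound.\<close>
  have rel: "fold (rmap ?M) (snd p) f = 0" if p: "p \<in> \<rho>" and f: "f \<in> rspace ?M (fst p)" for p f
  proof (rule ccontr)
    assume "\<not> ?thesis"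
    then obtain m where "fold (rmap ?M) (snd p) f m \<noteq> 0"
      by (auto simp: fun_eq_iff)
    from fold_rmap_tree_module_nonzero[OF this]
    obtain n q where q: "awalk n q m" "map F1 q = snd p" "f n \<noteq> 0"
      using f unfolding tree_module_simps by blast
    then have "(F0 n, map F1 q) = p"
      using f by (auto simp: prod_eq_iff)
    moreover have "(n, q) \<in> paths T" using q by (auto simp: paths_def)
    moreover have "path_in_ideal TYPE('k) Q \<rho> p"
      using p by (auto simp: path_in_ideal_def ideal_gen_def)
    ultimately show False
      using bm unfolding bound_morphism_def by force
  qed
  show ?thesis
    unfolding fd_rep_def tree_module_simps(1)
    by (intro conjI ballI span fin lin rel vector_space_fun_scale)
qed

section \<open>Direct sums of representations\<close>

lemma rep_dsum_simps [simp]: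
  "rscale (rep_dsum I V) c f i = rscale (V i) c (f i)"
  "f \<in> rspace (rep_dsum I V) x \<longleftrightarrow> (\<forall>i\<in>I. f i \<in> rspace (V i) x) \<and> (\<forall>i. i \<notin> I \<longrightarrow> f i = 0)"
  "rmap (rep_dsum I V) \<gamma> f i = (if i \<in> I then rmap (V i) \<gamma> (f i) else 0)"
  by (simp_all add: rep_dsum_def)

text \<open>The assumption covers the empty path, where \<open>rmap\<close> is never applied and
  cannot reset the entries outside \<open>I\<close> to 0.\<close>

lemma fold_rmap_rep_dsum:
  "(\<And>i. i \<notin> I \<Longrightarrow> f i = 0) \<Longrightarrow>
   fold (rmap (rep_dsum I V)) gs f i = (if i \<in> I then fold (rmap (V i)) gs (f i) else 0)"
  by (induction gs arbitrary: f) auto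

lemma vector_space_rep_dsum:
  assumes "\<And>i. vector_space (rscale (V i))"
  shows "vector_space (rscale (rep_dsum I V))"
  using assms by (auto simp: vector_space_def fun_eq_iff)

text \<open>The scalar multiplication of \<open>rep_dsum\<close> also involves the indices outside \<open>I\<close>.\<close>

lemma fd_rep_rep_dsum:
  fixes V :: "'i \<Rightarrow> ('x, 'g, 'k::field, 'm::ab_group_add) qrep"
  assumes "finite I" and V: "\<And>i. i \<in> I \<Longrightarrow> fd_rep Q \<rho> (V i)"
    and vs: "\<And>i. vector_space (rscale (V i))"
  shows "fd_rep Q \<rho> (rep_dsum I V)"
proof -
  let ?W = "rep_dsum I V"
  interpret W: vector_space "rscale ?W" by (rule vector_space_rep_dsum) (rule vs)
  have module: "module (rscale (V i))" for i
    using vs by (simp add: module_iff_vector_space)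
  \<comment> \<open>Entries outside \<open>I\<close>, and all but one entry of the embedded vectors
    below, are 0 and have to stay 0 under scaling.\<close>
  have scale_zero: "rscale (V i) c 0 = 0" for i c
    by (rule module.scale_zero_right[OF module])
  have span: "\<exists>B. finite B \<and> W.span B = rspace ?W x" if x: "x \<in> verts Q" for x
  proof -
    have "\<exists>B. finite B \<and> module.span (rscale (V i)) B = rspace (V i) x" if "i \<in> I" for i
      using V[OF that] x by (simp add: fd_rep_def)
    then obtain B where B: "\<And>i. i \<in> I \<Longrightarrow> finite (B i)"
      "\<And>i. i \<in> I \<Longrightarrow> module.span (rscale (V i)) (B i) = rspace (V i) x"
      by metis
    \<comment> \<open>The embedding of the \<open>i\<close>-th summand; the embedded spanning sets
      together span the direct sum.\<close>
    define inc where "inc = (\<lambda>(i::'i) (b::'m) j. if j = i then b else 0)"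
    let ?B = "\<Union>i\<in>I. inc i ` B i"
    have sub: "module.subspace (rscale (V i)) (rspace (V i) x)"
      and base: "B i \<subseteq> rspace (V i) x" if "i \<in> I" for i
    proof -
      interpret Vi: vector_space "rscale (V i)" by (rule vs)
      show "Vi.subspace (rspace (V i) x)" "B i \<subseteq> rspace (V i) x"
        using B(2)[OF that] Vi.subspace_span Vi.span_superset by metis+
    qed
    have zero: "0 \<in> rspace (V i) x" if "i \<in> I" for i
      using sub[OF that] module.subspace_def[OF module] by blast
    have "W.span ?B = rspace ?W x"
    proof
      have "W.subspace (rspace ?W x)"
      proof (rule W.subspaceI)
        show "0 \<in> rspace ?W x"
          using zero by simp
        show "f + g \<in> rspace ?W x" if "f \<in> rspace ?W x" "g \<in> rspace ?W x" for f g
          using that sub by (simp add: module.subspace_def[OF module])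
        show "rscale ?W c f \<in> rspace ?W x" if "f \<in> rspace ?W x" for c f
          using that sub by (simp add: module.subspace_def[OF module] scale_zero)
      qed
      moreover have "inc i b \<in> rspace ?W x" if "i \<in> I" "b \<in> B i" for i b
        using that base zero by (auto simp: inc_def)
      ultimately show "W.span ?B \<subseteq> rspace ?W x"
        by (intro W.span_minimal) auto
      show "rspace ?W x \<subseteq> W.span ?B"
      proof
        fix f assume f: "f \<in> rspace ?W x"
        have inc: "inc i b \<in> W.span ?B" if i: "i \<in> I" and b: "b \<in> rspace (V i) x" for i b
        proof -
          interpret Vi: vector_space "rscale (V i)" by (rule vs)
          have "b \<in> Vi.span (B i)" using b B(2)[OF i] by simp
          then show ?thesis
          proof (induction rule: Vi.span_induct_alt)
            case base
            have "inc i 0 = 0" by (simp add: inc_def fun_eq_iff)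
            then show ?case by (metis W.span_zero)
          next
            case (step c b b')
            have eq: "inc i (rscale (V i) c b + b') = rscale ?W c (inc i b) + inc i b'"
              by (simp add: inc_def fun_eq_iff scale_zero)
            have "inc i b \<in> ?B" using step i by blast
            then show ?case
              unfolding eq using \<open>inc i b' \<in> W.span ?B\<close>
              by (intro W.span_add[OF W.span_scale[OF W.span_base]])
          qed
        qed
        have "f = (\<Sum>i\<in>I. inc i (f i))"
          using f \<open>finite I\<close> by (auto simp: fun_eq_iff sum_fun_apply inc_def)
        also have "\<dots> \<in> W.span ?B"
          using f by (intro W.span_sum inc) auto
        finally show "f \<in> W.span ?B" .
      qed
    qed
    moreover have "finite ?B" using \<open>finite I\<close> B(1) by auto
    ultimately show ?thesis by blast
  qed
  have "{x \<in> verts Q. rspace ?W x \<noteq> {0}} \<subseteq> (\<Union>i\<in>I. {x \<in> verts Q. rspace (V i) x \<noteq> {0}})"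
  proof (clarify, rule ccontr)
    fix x assume x: "x \<in> verts Q" "rspace ?W x \<noteq> {0}"
      and "x \<notin> (\<Union>i\<in>I. {x \<in> verts Q. rspace (V i) x \<noteq> {0}})"
    then have "\<And>i. i \<in> I \<Longrightarrow> rspace (V i) x = {0}" by auto
    then have "f \<in> rspace ?W x \<longleftrightarrow> f = 0" for f
      by (auto simp: fun_eq_iff)
    then have "rspace ?W x = {0}" by blast
    with x(2) show False by simp
  qed
  moreover have "finite (\<Union>i\<in>I. {x \<in> verts Q. rspace (V i) x \<noteq> {0}})"
    using \<open>finite I\<close> V by (auto simp: fd_rep_def)
  ultimately have fin: "finite {x \<in> verts Q. rspace ?W x \<noteq> {0}}"
    by (rule finite_subset)
  have lin: "linear_between (rscale ?W) (rspace ?W (tail Q \<gamma>)) (rscale ?W) (rspace ?W (head Q \<gamma>)) (rmap ?W \<gamma>)"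
    if \<gamma>: "\<gamma> \<in> arcs Q" for \<gamma>
  proof -
    have *: "linear_between (rscale (V i)) (rspace (V i) (tail Q \<gamma>))
               (rscale (V i)) (rspace (V i) (head Q \<gamma>)) (rmap (V i) \<gamma>)" if "i \<in> I" for i
      using V[OF that] \<gamma> by (simp add: fd_rep_def)
    then show ?thesis
      unfolding linear_between_def by (simp add: fun_eq_iff scale_zero)
  qed
  have rel: "fold (rmap ?W) (snd p) f = 0" if "p \<in> \<rho>" "f \<in> rspace ?W (fst p)" for p f
    using that V by (auto simp: fun_eq_iff fold_rmap_rep_dsum fd_rep_def)
  show ?thesis
    unfolding fd_rep_def using W.vector_space_axioms span fin lin rel by blast
qed

section \<open>Restriction to induced subquivers\<close>

lemma fin_digraph_induce:
  assumes "fin_digraph T" "X \<subseteq> verts T"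
  shows "fin_digraph (T \<restriction> X)"
proof -
  interpret fin_digraph T by fact
  show ?thesis
    by unfold_locales (use assms finite_subset[OF assms(2)] in auto)
qed

text \<open>Inducing a subquiver keeps \<open>tail\<close> and \<open>head\<close>, so the condition
  \<open>cas\<close> on consecutive arrows is unchanged; only the sets of vertices and arrows
  shrink.\<close>

lemma paths_induce: "X \<subseteq> verts T \<Longrightarrow> paths (T \<restriction> X) \<subseteq> paths T"
proof -
  assume X: "X \<subseteq> verts T"
  have "pre_digraph.cas (T \<restriction> X) = pre_digraph.cas T"
    by (rule compatible_cas) (simp add: compatible_def)
  with X show ?thesis
    by (auto simp: paths_def pre_digraph.awalk_def)
qed

lemma bound_morphism_induce:
  assumes "bound_morphism K T Q \<rho> F0 F1" "X \<subseteq> verts T"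
  shows "bound_morphism K (T \<restriction> X) Q \<rho> F0 F1"
  using assms paths_induce[OF assms(2)]
  by (auto simp: bound_morphism_def quiver_morphism_def)

section \<open>The splitting induced by an idempotent\<close>

text \<open>With injective heads \<open>a\<close> is the only arrow into its head, so the sum in
  \<open>rmap_tree_module\<close> has at most one term.\<close>

lemma (in fin_digraph) rmap_tree_module_at_head:
  assumes "inj_on (head G) (arcs G)" "a \<in> arcs G"
  shows "rmap (tree_module G F0 F1) \<gamma> f (head G a) = (if F1 a = \<gamma> then f (tail G a) else 0)"
proof -
  have "in_arcs G (head G a) = {a}"
    using assms by (auto simp: in_arcs_def dest: inj_onD)
  then have "{b \<in> in_arcs G (head G a). F1 b = \<gamma>} = (if F1 a = \<gamma> then {a} else {})" by auto
  then show ?thesis by (simp add: rmap_tree_module)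
qed

lemma sum_eq_single:
  fixes f :: "'i \<Rightarrow> 'm::comm_monoid_add"
  assumes "finite I" "i \<in> I" "\<And>j. j \<in> I \<Longrightarrow> j \<noteq> i \<Longrightarrow> f j = 0"
  shows "sum f I = f i"
proof -
  have "sum f I = sum f {i}"
    using assms by (intro sum.mono_neutral_right) auto
  then show ?thesis by simp
qed

text \<open>
  Here \<open>C z\<close> is the image of the idempotent; the \<open>C j\<close> with \<open>j \<noteq> z\<close> need not be connected, only
  closed under the arcs of \<open>T\<close> outside the image.
\<close>

lemma tree_module_split:
  fixes F0 :: "'n \<Rightarrow> 'x" and F1 :: "'a \<Rightarrow> 'g" and I :: "'n set" and C :: "'i \<Rightarrow> 'n set"
  assumes fin: "fin_digraph T"
    and inj: "inj_on (head T) (arcs T)"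
    and bm: "bound_morphism TYPE('k::field) T Q \<rho> F0 F1"
    and \<iota>: "quiver_morphism T T \<iota>0 \<iota>1"
    and F\<iota>: "\<And>n. n \<in> verts T \<Longrightarrow> F0 (\<iota>0 n) = F0 n" "\<And>a. a \<in> arcs T \<Longrightarrow> F1 (\<iota>1 a) = F1 a"
    and I: "I \<subseteq> verts T" "\<And>n. n \<in> verts T \<Longrightarrow> \<iota>0 n \<in> I" "\<And>n. n \<in> I \<Longrightarrow> \<iota>0 n = n"
    and root: "\<And>n. n \<in> verts T - I \<Longrightarrow> \<exists>a\<in>arcs T. head T a = n"
    and tail: "\<And>a. a \<in> arcs T \<Longrightarrow> head T a \<in> I \<Longrightarrow> tail T a \<in> I"
    and J: "finite J" "z \<in> J" and Cz: "C z = I"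
    and C: "disjoint_family_on C J" "(\<Union>j\<in>J. C j) = verts T"
    and arc: "\<And>a j. a \<in> arcs T \<Longrightarrow> j \<in> J \<Longrightarrow> j \<noteq> z \<Longrightarrow> head T a \<in> C j \<Longrightarrow> tail T a \<notin> I \<Longrightarrow> tail T a \<in> C j"
  shows "rep_iso Q \<rho>
           (tree_module T F0 F1 :: ('x, 'g, 'k, 'n \<Rightarrow> 'k) qrep)
           (rep_dsum J (\<lambda>j. tree_module (T \<restriction> C j) F0 F1))"
proof -
  interpret fin_digraph T by fact
  let ?M = "tree_module T F0 F1 :: ('x, 'g, 'k, 'n \<Rightarrow> 'k) qrep"
  let ?V = "\<lambda>j. tree_module (T \<restriction> C j) F0 F1 :: ('x, 'g, 'k, 'n \<Rightarrow> 'k) qrep"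
  let ?W = "rep_dsum J ?V"
  have sub: "C j \<subseteq> verts T" if "j \<in> J" for j
    using that C(2) by auto
  have fin_C: "fin_digraph (T \<restriction> C j)" if "j \<in> J" for j
    using fin_digraph_induce[OF fin sub[OF that]] .
  have ind: "n \<in> C i \<Longrightarrow> n \<in> C j \<Longrightarrow> i \<in> J \<Longrightarrow> j \<in> J \<Longrightarrow> i = j" for n i j
    using C(1) unfolding disjoint_family_on_def by blast
  have C_I: "n \<in> I \<longleftrightarrow> j = z" if "n \<in> C j" "j \<in> J" for n j
    using that ind J(2) Cz by blast
  have \<iota>1: "\<iota>1 a \<in> arcs T" "tail T (\<iota>1 a) = \<iota>0 (tail T a)" "head T (\<iota>1 a) = \<iota>0 (head T a)"
    if "a \<in> arcs T" for a
    using \<iota> that by (simp_all add: quiver_morphism_def)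
  \<comment> \<open>Restriction to the image in component \<open>z\<close>, and \<open>f\<close>
    minus its pullback along \<open>\<iota>0\<close> in the others. The formula does not mention the
    vertex of \<open>Q\<close>, so one map serves at all of them.\<close>
  define \<phi> where "\<phi> = (\<lambda>(f :: 'n \<Rightarrow> 'k) j m. if j \<in> J \<and> m \<in> C j
    then if j = z then f m else f m - f (\<iota>0 m) else 0)"
  \<comment> \<open>The inverse of \<open>\<phi>\<close>: the sum glues pieces with disjoint
    supports, and the second term restores the value at \<open>\<iota>0 n\<close> that
    \<open>\<phi>\<close> subtracted.\<close>
  define \<psi> where "\<psi> = (\<lambda>(g :: 'i \<Rightarrow> 'n \<Rightarrow> 'k) n.
    (\<Sum>j\<in>J. g j n) + (if n \<in> verts T - I then g z (\<iota>0 n) else 0))"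

  \<comment> \<open>Since \<open>F0 (\<iota>0 m) = F0 m\<close>, both values in the difference
    belong to the same vertex of \<open>Q\<close>.\<close>
  have \<phi>_space: "\<phi> f \<in> rspace ?W x" if f: "f \<in> rspace ?M x" for f x
  proof -
    have "m \<in> C j \<and> F0 m = x" if nz: "\<phi> f j m \<noteq> 0" for j m
    proof -
      have m: "j \<in> J" "m \<in> C j" "f m \<noteq> 0 \<or> f (\<iota>0 m) \<noteq> 0"
        using nz by (auto simp: \<phi>_def split: if_splits)
      then have "F0 m = x \<or> F0 (\<iota>0 m) = x" using f by auto
      moreover have "m \<in> verts T" using m sub by blast
      ultimately show ?thesis using m F\<iota>(1) by auto
    qed
    moreover have "\<phi> f j = 0" if "j \<notin> J" for j
      using that by (simp add: \<phi>_def fun_eq_iff)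
    ultimately show ?thesis using sub by (force simp: induce_subgraph_verts)
  qed

  have W_zero: "g j n = 0" if "g \<in> rspace ?W x" "n \<notin> C j \<or> j \<notin> J" for g x j n
    using that by (auto simp: fun_eq_iff)

  have \<psi>_space: "\<psi> g \<in> rspace ?M x" if g: "g \<in> rspace ?W x" for g x
  proof -
    have "n \<in> verts T \<and> F0 n = x" if nz: "\<psi> g n \<noteq> 0" for n
    proof (cases "\<exists>j\<in>J. g j n \<noteq> 0")
      case True
      then show ?thesis using g sub by fastforce
    next
      case False
      then have "n \<in> verts T" "g z (\<iota>0 n) \<noteq> 0"
        using nz by (auto simp: \<psi>_def split: if_splits)
      moreover from this have "F0 (\<iota>0 n) = x" using g J(2) by auto
      ultimately show ?thesis using F\<iota>(1) by auto
    qed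
    then show ?thesis by simp
  qed

  \<comment> \<open>Only a support condition at \<open>n\<close> is assumed, so that this applies
    both to \<open>\<phi> f\<close> and to any \<open>g\<close> in the direct sum.\<close>
  have \<psi>_at: "\<psi> g n = g j n + (if j = z then 0 else g z (\<iota>0 n))"
    if "\<And>i. i \<in> J \<Longrightarrow> n \<notin> C i \<Longrightarrow> g i n = 0" "j \<in> J" "n \<in> C j" for g n j
  proof -
    have "(\<Sum>i\<in>J. g i n) = g j n"
      using that ind J(1) by (intro sum_eq_single) blast+
    then show ?thesis
      using that sub C_I by (auto simp: \<psi>_def)
  qed

  have \<psi>\<phi>: "\<psi> (\<phi> f) = f" if f: "f \<in> rspace ?M x" for f x
  proof
    fix n
    show "\<psi> (\<phi> f) n = f n"
    proof (cases "n \<in> verts T")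
      case True
      then obtain j where j: "j \<in> J" "n \<in> C j" using C(2) by auto
      then have "\<psi> (\<phi> f) n = \<phi> f j n + (if j = z then 0 else \<phi> f z (\<iota>0 n))"
        by (intro \<psi>_at) (auto simp: \<phi>_def)
      also have "\<dots> = f n"
        using j J(2) I(2)[OF True] Cz by (auto simp: \<phi>_def)
      finally show ?thesis .
    next
      case False
      then have "\<phi> f j n = 0" for j
        using sub by (auto simp: \<phi>_def)
      moreover have "f n = 0" using f False by auto
      ultimately show ?thesis using False by (simp add: \<psi>_def)
    qed
  qed

  have \<phi>\<psi>: "\<phi> (\<psi> g) = g" if g: "g \<in> rspace ?W x" for g x
  proof (intro ext)
    fix j m
    show "\<phi> (\<psi> g) j m = g j m"
    proof (cases "j \<in> J \<and> m \<in> C j")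
      case True
      have at: "\<psi> g n = g i n + (if i = z then 0 else g z (\<iota>0 n))" if "i \<in> J" "n \<in> C i" for n i
        using that W_zero[OF g] by (intro \<psi>_at) auto
      \<comment> \<open>The vertex \<open>\<iota>0 m\<close> lies in the image, where
        \<open>\<psi> g\<close> is just \<open>g z\<close>.\<close>
      have "\<psi> g (\<iota>0 m) = g z (\<iota>0 m)"
        using at[of z "\<iota>0 m"] J(2) Cz I(2) True sub by auto
      with True at[of j m] show ?thesis by (simp add: \<phi>_def)
    next
      case False
      then show ?thesis using W_zero[OF g] by (auto simp: \<phi>_def)
    qed
  qed

  have comm: "\<phi> (rmap ?M \<gamma> f) = rmap ?W \<gamma> (\<phi> f)" for \<gamma> f
  proof (intro ext)
    fix j m
    show "\<phi> (rmap ?M \<gamma> f) j m = rmap ?W \<gamma> (\<phi> f) j m"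
    proof (cases "j \<in> J")
      case j: True
      interpret Cj: fin_digraph "T \<restriction> C j" by (rule fin_C[OF j])
      have inj_C: "inj_on (head (T \<restriction> C j)) (arcs (T \<restriction> C j))"
        using inj by (auto simp: inj_on_def)
      have no_arc: "rmap (?V j) \<gamma> (\<phi> f j) m = 0" if "\<And>a. a \<in> arcs (T \<restriction> C j) \<Longrightarrow> head T a \<noteq> m"
        unfolding Cj.rmap_tree_module using that by (intro sum.neutral) auto
      consider "m \<notin> C j" | "m \<in> C j" "\<not> (\<exists>a\<in>arcs T. head T a = m)"
        | a where "a \<in> arcs T" "head T a = m" "m \<in> C j" by blast
      then show ?thesis
      proof cases
        case 1
        then show ?thesis using j no_arc by (auto simp: \<phi>_def)
      next
        case 2
        \<comment> \<open>By \<open>root\<close>, a vertex without incoming arrow lies in the image,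
          so no difference has to be evaluated here.\<close>
        then have "m \<in> I" using root sub[OF j] by blast
        then have "j = z" using C_I 2 j by blast
        moreover have "rmap ?M \<gamma> f m = 0"
          unfolding rmap_tree_module using 2 by (intro sum.neutral) auto
        ultimately show ?thesis using 2 j no_arc by (auto simp: \<phi>_def)
      next
        case 3
        note a = 3(1) 3(2)[symmetric]
        \<comment> \<open>The arrow into \<open>\<iota>0 m\<close> is \<open>\<iota>1 a\<close>,
          which lies over the same arrow of \<open>Q\<close> as \<open>a\<close>.\<close>
        have M: "rmap ?M \<gamma> f m = (if F1 a = \<gamma> then f (tail T a) else 0)"
          "rmap ?M \<gamma> f (\<iota>0 m) = (if F1 a = \<gamma> then f (\<iota>0 (tail T a)) else 0)"
          using rmap_tree_module_at_head[OF inj a(1), of F0 F1 \<gamma> f]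
            rmap_tree_module_at_head[OF inj \<iota>1(1)[OF a(1)], of F0 F1 \<gamma> f] \<iota>1[OF a(1)] F\<iota>(2)[OF a(1)] a(2)
          by auto
        show ?thesis
        proof (cases "tail T a \<in> C j")
          case True
          then have "rmap (?V j) \<gamma> (\<phi> f j) m = (if F1 a = \<gamma> then \<phi> f j (tail T a) else 0)"
            using Cj.rmap_tree_module_at_head[OF inj_C, of a F0 F1 \<gamma> "\<phi> f j"] 3 by simp
          then show ?thesis using M j 3 True by (simp add: \<phi>_def)
        next
          case False
          \<comment> \<open>Here \<open>a\<close> enters the component from the image. Its tail is
            fixed by \<open>\<iota>0\<close>, so the two terms of the difference cancel; in the
            subquiver \<open>m\<close> has no incoming arrow, so the other side vanishes as
            well.\<close>
          have "j \<noteq> z" using False tail[OF a(1)] 3 Cz by auto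
          then have "tail T a \<in> I" using False arc[OF a(1) j] 3 by auto
          then have "\<phi> (rmap ?M \<gamma> f) j m = 0"
            using M I(3) j 3 \<open>j \<noteq> z\<close> by (simp add: \<phi>_def)
          moreover have "rmap (?V j) \<gamma> (\<phi> f j) m = 0"
            using False inj a by (intro no_arc) (auto dest: inj_onD)
          ultimately show ?thesis using j by simp
        qed
      qed
    qed (simp add: \<phi>_def)
  qed

  have fdV: "fd_rep Q \<rho> (?V j)" if "j \<in> J" for j
    using fd_rep_tree_module[OF fin_C[OF that] bound_morphism_induce[OF bm sub[OF that]]] .
  have "fd_rep Q \<rho> ?M"
    using fd_rep_tree_module[OF fin bm] .
  moreover have "fd_rep Q \<rho> ?W"
    using J(1) fdV vector_space_fun_scale by (intro fd_rep_rep_dsum) auto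
  moreover have "linear_between (rscale ?M) (rspace ?M x) (rscale ?W) (rspace ?W x) \<phi>" for x
    unfolding linear_between_def
    using \<phi>_space by (auto simp: \<phi>_def fun_eq_iff fun_scale_def algebra_simps simp del: tree_module_simps(2) rep_dsum_simps(2))
  moreover have "bij_betw \<phi> (rspace ?M x) (rspace ?W x)" for x
    by (rule bij_betw_byWitness[where f' = \<psi>]) (use \<phi>_space \<psi>_space \<phi>\<psi> \<psi>\<phi> in blast)+
  ultimately show ?thesis
    unfolding rep_iso_def using comm by (intro conjI exI[of _ "\<lambda>_. \<phi>"]) simp_all
qed

theorem lemma4p10:
  fixes Q :: "('x, 'g) pre_digraph" and \<rho> :: "('x, 'g) path set"
    and T :: "('n, 'a) pre_digraph"
    and F0 :: "'n \<Rightarrow> 'x" and F1 :: "'a \<Rightarrow> 'g"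
    and \<iota>0 :: "'n \<Rightarrow> 'n" and \<iota>1 :: "'a \<Rightarrow> 'a"
    and k :: nat and Tc :: "nat \<Rightarrow> 'n set"
  assumes "CHAR('k::field) \<noteq> 2"
    and "bound_quiver TYPE('k) Q \<rho>"
    and "rooted_tree T"
    and "bound_morphism TYPE('k) T Q \<rho> F0 F1"
    and "quiver_morphism T T \<iota>0 \<iota>1"
    and "\<forall>n\<in>verts T. \<iota>0 (\<iota>0 n) = \<iota>0 n"
    and "\<forall>a\<in>arcs T. \<iota>1 (\<iota>1 a) = \<iota>1 a"
    and "(\<exists>n\<in>verts T. \<iota>0 n \<noteq> n) \<or> (\<exists>a\<in>arcs T. \<iota>1 a \<noteq> a)"
    and "\<forall>n\<in>verts T. F0 (\<iota>0 n) = F0 n"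
    and "\<forall>a\<in>arcs T. F1 (\<iota>1 a) = F1 a"
    and "bij_betw Tc {1..k} (components (T \<restriction> (verts T - \<iota>0 ` verts T)))"
  shows "rep_iso Q \<rho>
           (tree_module T F0 F1 :: ('x, 'g, 'k, 'n \<Rightarrow> 'k) qrep)
           (rep_dsum {0..k} (\<lambda>j. tree_module (T \<restriction> (if j = 0 then \<iota>0 ` verts T else Tc j)) F0 F1))"
proof -
  let ?I = "\<iota>0 ` verts T"
  let ?G = "T \<restriction> (verts T - ?I)"
  let ?C = "\<lambda>j. if j = 0 then ?I else Tc j"
  obtain r where fin: "fin_digraph T" and acyc: "\<nexists>p. undirected_cycle T p"
    and r: "\<And>n. n \<in> verts T \<Longrightarrow> in_arcs T n = {} \<Longrightarrow> n = r"
    using assms(3) unfolding rooted_tree_def quiver_tree_def by metis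
  interpret fin_digraph T by fact
  have reach: "r \<rightarrow>\<^sup>*\<^bsub>T\<^esub> n" if "n \<in> verts T" for n
    using reachable_from_unique_source[OF _ r that] acyc cycle_imp_undirected_cycle by blast
  have inj: "inj_on (head T) (arcs T)"
    by (rule inj_onI) (rule in_arc_unique[OF acyc reach])
  have \<iota>: "\<And>n. n \<in> verts T \<Longrightarrow> \<iota>0 n \<in> verts T" "\<And>a. a \<in> arcs T \<Longrightarrow> \<iota>1 a \<in> arcs T"
    "\<And>a. a \<in> arcs T \<Longrightarrow> tail T (\<iota>1 a) = \<iota>0 (tail T a)"
    "\<And>a. a \<in> arcs T \<Longrightarrow> head T (\<iota>1 a) = \<iota>0 (head T a)"
    using assms(5) by (simp_all add: quiver_morphism_def)
  have fixI: "\<iota>0 n = n" if "n \<in> ?I" for n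
    using that assms(6) by auto
  have tail: "tail T a \<in> ?I" if a: "a \<in> arcs T" "head T a \<in> ?I" for a
  proof -
    \<comment> \<open>Both arrows end at \<open>head T a\<close>, which \<open>\<iota>0\<close>
      fixes, and heads are injective on arrows.\<close>
    have "\<iota>1 a = a"
      using inj_onD[OF inj] \<iota>(2,4)[OF a(1)] fixI a by metis
    then show ?thesis using \<iota>(3)[OF a(1)] a by (metis imageI tail_in_verts)
  qed
  \<comment> \<open>Take any vertex of the image and go back to \<open>r\<close> along a walk;
    \<open>tail\<close> keeps every predecessor in the image.\<close>
  have rI: "r \<in> ?I"
  proof -
    have "\<exists>n. n \<in> verts T" using assms(3) unfolding rooted_tree_def by blast
    then obtain n where n: "n \<in> ?I" "n \<in> verts T" using \<iota>(1) by blast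
    then have "r \<rightarrow>\<^sup>*\<^bsub>T\<^esub> n" using reach by blast
    then show ?thesis using n(1)
    proof (induction rule: converse_reachable_induct)
      case (step x y)
      then obtain a where "a \<in> arcs T" "tail T a = x" "head T a = y"
        by (auto simp: arcs_ends_conv)
      then show ?case using tail[of a] step.IH[OF step.prems] by simp
    qed
  qed
  have root: "\<exists>a\<in>arcs T. head T a = n" if "n \<in> verts T - ?I" for n
    using r[of n] rI that by (auto simp: in_arcs_def)
  interpret G: fin_digraph ?G
    by (rule fin_digraph_induce) (use fin in auto)
  have Tc: "inj_on Tc {1..k}" "Tc ` {1..k} = components ?G"
    using assms(11) by (auto simp: bij_betw_def)
  have UnTc: "(\<Union>j\<in>{1..k}. Tc j) = verts T - ?I"
    using Union_components[of ?G] Tc(2) by simp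
  have sub: "Tc j \<subseteq> verts T - ?I" if "j \<in> {1..k}" for j
    using that UnTc by blast
  have split: "{0..k} = insert 0 {1..k}" by auto
  show ?thesis
  \<comment> \<open>Index 0 carries the image and the indices from 1 to \<open>k\<close> the
    components of its complement.\<close>
  proof (rule tree_module_split[OF fin inj assms(4,5), where I = ?I and z = 0])
    show "disjoint_family_on ?C {0..k}"
    proof (unfold disjoint_family_on_def, intro ballI impI)
      fix i j assume ij: "i \<in> {0..k}" "j \<in> {0..k}" "i \<noteq> j"
      show "?C i \<inter> ?C j = {}"
      proof (cases "i = 0 \<or> j = 0")
        case True
        then have "i \<in> {1..k} \<and> j = 0 \<or> j \<in> {1..k} \<and> i = 0" using ij by auto
        then show ?thesis using sub[of i] sub[of j] by (elim disjE conjE; simp; blast)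
      next
        case False
        then have "i \<in> {1..k}" "j \<in> {1..k}" using ij by auto
        then show ?thesis
          using ij(3) components_disjoint[of "Tc i" ?G "Tc j"] Tc inj_onD[OF Tc(1)] False
          by (metis imageI)
      qed
    qed
    have "(\<Union>j\<in>{0..k}. ?C j) = ?I \<union> (\<Union>j\<in>{1..k}. Tc j)"
      unfolding split by auto
    then show "(\<Union>j\<in>{0..k}. ?C j) = verts T"
      using UnTc \<iota>(1) by auto
    show "tail T a \<in> ?C j"
      if "a \<in> arcs T" "j \<in> {0..k}" "j \<noteq> 0" "head T a \<in> ?C j" "tail T a \<notin> ?I" for a j
    proof -
      have j: "j \<in> {1..k}" using that by auto
      then have "Tc j \<in> components ?G" using Tc(2) by blast
      \<comment> \<open>Both ends of \<open>a\<close> avoid the image, so \<open>a\<close> survives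
        in \<open>?G\<close> and cannot leave the component.\<close>
      moreover have "a \<in> arcs ?G" using that sub[OF j] by auto
      ultimately show ?thesis
        using G.components_closed_arc[of "Tc j" a] that by simp
    qed
    show "F0 (\<iota>0 n) = F0 n" if "n \<in> verts T" for n using assms(9) that by blast
    show "F1 (\<iota>1 a) = F1 a" if "a \<in> arcs T" for a using assms(10) that by blast
    show "?I \<subseteq> verts T" using \<iota>(1) by blast
    show "\<iota>0 n \<in> ?I" if "n \<in> verts T" for n using that by blast
    show "\<iota>0 n = n" if "n \<in> ?I" for n using fixI that by blast
    show "\<exists>a\<in>arcs T. head T a = n" if "n \<in> verts T - ?I" for n using root that by blast
    show "tail T a \<in> ?I" if "a \<in> arcs T" "head T a \<in> ?I" for a using tail that by blast
  qed simp_all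
qed

end
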